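(* Suppose the support of the prior $\pi$ is partitioned as $\mathcal{F}_n\cup\mathcal{F}_n^c$ with $\mathcal F_n\subset\mathcal H_n$ bounded, and suppose there exists a deterministic sequence $\delta_n>0$ such that: (i) (Tail condition) as $q_n\to\infty$ and $n\to\infty$, either $E\,P(g_b\in\mathcal{F}_n^c\mid X^n)=o(1)$ or $\pi(\mathcal{F}_n^c)=O(e^{-4n\delta_n})$; (ii) (Approximation condition) $\pi\bigl(G(g_b)-\inf_{g\in\mathcal H}G(g)<\delta_n,\ g_b\in\mathcal{F}_n\bigr)\succ e^{-2n\delta_n}$; (iii) (Uniform convergence) $P\bigl[\sup_{g\in\mathcal{F}_n}|\bar G(g)-G(g)|\geq\delta_n\bigr]=o(1)$; (iv) (Distinguishing ability) for any $\varepsilon>0$, $\inf_{g\in\mathcal{H}_n,\,g\notin\Theta_I^{\varepsilon}}G(g)-\inf_{g\in\mathcal{H}}G(g)\succ\delta_n$. Then for any $\varepsilon>0$, $P(g_b\in\Theta_I^{\varepsilon}\mid X^n)\to 1$ in probability.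
   Context: $(\mathcal H,\|\cdot\|_s)$ is an infinite-dimensional Banach space of functions; $\phi_1,\phi_2,\ldots\in\mathcal H$ are basis functions; $q_n\to\infty$ is a deterministic sequence of integers; $\mathcal H_n=\mathrm{span}\{\phi_1,\ldots,\phi_{q_n}\}$ (a sieve space growing dense in $\mathcal H$). For $b=(b_1,\ldots,b_{q_n})^T\in\mathbb R^{q_n}$, $g_b=\sum_{i=1}^{q_n}b_i\phi_i$. $X^n=(X_1,\ldots,X_n)$ are i.i.d. observations. The sample risk functional $\bar G:\mathcal H_n\to[0,\infty)$ is a stochastic functional (depending on the data $X^n$), and $G$ is a nonnegative deterministic functional on $\mathcal H$ (the risk functional). A prior $\pi$ is placed on $b\in\mathbb R^{q_n}$ (equivalently on $g_b\in\mathcal H_n$), and the quasi-posterior is $P(g_b\mid X^n)\propto\pi(b)L(g_b)$ with $L(g_b)=\exp(-\tfrac n2\bar G(g_b))$. $E$ and unconditional $P$ refer to the distribution of the data. The identified region is $\Theta_I=\arg\min_{g\in\mathcal H}G(g)$ (not necessarily a singleton); $d(g_1,\Theta_I)=\inf_{g\in\Theta_I}\|g_1-g\|_s$; $\Theta_I^{\varepsilon}=\{g\in\mathcal H: d(g,\Theta_I)<\varepsilon\}$. For positive sequences, $a_n\succ b_n$ means $b_n=o(a_n)$.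
   Formalization: The tail bound π(F_n^c)=O(e^{-4nδ_n}) is replaced by O(e^{-4nδ_n}·e^{-(n/2) inf G}), the same when inf G=0; as stated the claim fails for inf G>0, since the sample risk may vanish off F_n. Measurability of the risks and events involved is assumed. *)

theory Defs
  imports "HOL-Probability.Probability"
begin

definition sieve_space :: "(nat \<Rightarrow> 'h::real_vector) \<Rightarrow> nat \<Rightarrow> 'h set" where
  "sieve_space \<phi> k = span (\<phi> ` {1..k})"

(* Coefficient vectors in R^k are functions on the index set {1..k}, i.e. points of coeff_space k. *)
abbreviation coeff_space :: "nat \<Rightarrow> (nat \<Rightarrow> real) measure" where
  "coeff_space k \<equiv> Pi\<^sub>M {1..k} (\<lambda>_. borel)"

definition sieve_elem :: "(nat \<Rightarrow> 'h::real_vector) \<Rightarrow> nat \<Rightarrow> (nat \<Rightarrow> real) \<Rightarrow> 'h" where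
  "sieve_elem \<phi> k b = (\<Sum>i=1..k. b i *\<^sub>R \<phi> i)"

definition sample_vec :: "(nat \<Rightarrow> 'w \<Rightarrow> 'x) \<Rightarrow> nat \<Rightarrow> 'w \<Rightarrow> (nat \<Rightarrow> 'x)" where
  "sample_vec X n \<omega> = (\<lambda>i\<in>{1..n}. X i \<omega>)"

definition quasi_lik :: "nat \<Rightarrow> ('h \<Rightarrow> real) \<Rightarrow> 'h \<Rightarrow> real" where
  "quasi_lik n Gb g = exp (- (real n / 2) * Gb g)"

(* The law of the coefficient vector under the quasi-posterior.  The prior pi is an arbitrary
   probability measure; a prior density p is the case
   pi = density (Pi_M {1..k} (%_. lborel)) p. *)
definition quasi_posterior ::
    "(nat \<Rightarrow> 'h::real_vector) \<Rightarrow> nat \<Rightarrow> nat \<Rightarrow> (nat \<Rightarrow> real) measure \<Rightarrow> ('h \<Rightarrow> real)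
      \<Rightarrow> (nat \<Rightarrow> real) measure" where
  "quasi_posterior \<phi> k n \<pi> Gb =
     density \<pi> (\<lambda>b. ennreal (quasi_lik n Gb (sieve_elem \<phi> k b)
                      / (\<integral>b'. quasi_lik n Gb (sieve_elem \<phi> k b') \<partial>\<pi>)))"

(* The probability that g_b lies in A when b has law \<mu>. *)
definition coeff_prob ::
    "(nat \<Rightarrow> 'h::real_vector) \<Rightarrow> nat \<Rightarrow> (nat \<Rightarrow> real) measure \<Rightarrow> 'h set \<Rightarrow> real" where
  "coeff_prob \<phi> k \<mu> A = measure \<mu> {b \<in> space \<mu>. sieve_elem \<phi> k b \<in> A}"

(* Topological support of the law of g_b. *)
definition prior_support ::
    "(nat \<Rightarrow> 'h::real_normed_vector) \<Rightarrow> nat \<Rightarrow> (nat \<Rightarrow> real) measure \<Rightarrow> 'h set" where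
  "prior_support \<phi> k \<pi> = {g. \<forall>r>0. coeff_prob \<phi> k \<pi> (ball g r) > 0}"

definition identified_region :: "('h \<Rightarrow> real) \<Rightarrow> 'h set" where
  "identified_region G = {g. is_arg_min G (\<lambda>_. True) g}"

(* Valued in the extended reals so that the distance to the empty set is infinite;
   the library's infdist is 0 there. *)
definition ext_dist :: "'h::real_normed_vector \<Rightarrow> 'h set \<Rightarrow> ereal" where
  "ext_dist g A = (INF a\<in>A. ereal (norm (g - a)))"

definition enlargement :: "'h::real_normed_vector set \<Rightarrow> real \<Rightarrow> 'h set" where
  "enlargement A \<epsilon> = {g. ext_dist g A < ereal \<epsilon>}"

(* a succeeds b iff b = o(a); the dominating sequence may take the value \<infinity>, which is
   the infimum of a functional over an empty set. *)
definition dominates :: "(nat \<Rightarrow> ereal) \<Rightarrow> (nat \<Rightarrow> real) \<Rightarrow> bool" (infix "\<succ>\<succ>" 50) where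
  "a \<succ>\<succ> b \<longleftrightarrow> (\<forall>c>0. eventually (\<lambda>n. ereal (b n) \<le> ereal c * a n) sequentially)"

definition tendsto_in_prob :: "'w measure \<Rightarrow> (nat \<Rightarrow> 'w \<Rightarrow> real) \<Rightarrow> real \<Rightarrow> bool" where
  "tendsto_in_prob M Y c \<longleftrightarrow>
     (\<forall>\<eta>>0. (\<lambda>n. measure M {\<omega> \<in> space M. \<bar>Y n \<omega> - c\<bar> > \<eta>}) \<longlonglongrightarrow> 0)"

(* On the rate in the tail condition.  The second alternative reads
     prior(Fc n) = O(exp (- 4 n delta_n) * exp (- (n/2) * inf G)),
   which is O(exp (- 4 n delta_n)) when the minimal risk is 0.  The last factor cannot be dropped
   in general: on F n the quasi-likelihood is about exp (- (n/2) * G) <= exp (- (n/2) * inf G),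
   whereas off F n only Gbar >= 0 is known, so that for inf G > 0 and delta_n -> 0 a set of prior mass
   exp (- 4 n delta_n) on which Gbar = 0 carries all of the quasi-posterior in the limit. *)

end

theory Submission
  imports Defs
begin

text \<open>
  The quasi-posterior is a Gibbs measure: the prior reweighted by \<open>exp (- (n/2) V)\<close>, where \<open>V\<close> is
  the sample risk of \<open>g\<^sub>b\<close>, and divided by its normalising constant. Let \<open>m = inf G\<close> and fix data for
  which the sample risk is within \<open>\<delta>\<^sub>n\<close> of \<open>G\<close> on the sieve \<open>F\<^sub>n\<close>; by uniform convergence
  such data have probability tending to one. The elements of \<open>F\<^sub>n\<close> with \<open>G < m + \<delta>\<^sub>n\<close> then have
  sample risk at most \<open>m + 2 \<delta>\<^sub>n\<close>, and their prior mass eventually exceeds \<open>C exp (- 2 n \<delta>\<^sub>n)\<close> for every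
  \<open>C\<close>, so the normalising constant is at least \<open>C exp (- n m / 2 - 3 n \<delta>\<^sub>n)\<close>.

  The mass outside the enlarged identified region splits into two parts. On \<open>F\<^sub>n\<close>, the
  distinguishing condition gives \<open>G \<ge> m + 7 \<delta>\<^sub>n\<close> there, hence sample risk at least \<open>m + 6 \<delta>\<^sub>n\<close> and
  weight at most \<open>exp (- n m / 2 - 3 n \<delta>\<^sub>n)\<close>: the quasi-posterior mass is at most \<open>1 / C\<close>. Off \<open>F\<^sub>n\<close>, either
  the mass vanishes in mean and Markov's inequality applies, or the prior mass is at most
  \<open>B exp (- n m / 2 - 4 n \<delta>\<^sub>n)\<close> and the quasi-posterior mass is at most \<open>B / C\<close>. As \<open>C\<close> is arbitrary,
  both parts vanish. The ratio estimate common to both parts is \<open>gibbs_mass_le_ratio\<close>.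

  The remaining work is measure-theoretic. The function space need not be separable, but an open condition
  on \<open>g\<^sub>b\<close> pulls back along a continuous map from the second countable space of coefficients;
  this yields measurability (\<open>sets_vimage_sieve_elem\<close>) and the fact that \<open>g\<^sub>b\<close> lies in the support
  of the prior almost surely (\<open>AE_sieve_elem_in_prior_support\<close>), so that \<open>F\<^sub>n\<close> and \<open>Fc\<^sub>n\<close>
  exhaust the mass. Markov's inequality also needs the quasi-posterior mass to be measurable in the
  data (\<open>measurable_gibbs_mass\<close>).
\<close>

section \<open>Gibbs measures\<close>

definition gibbs :: "'a measure \<Rightarrow> real \<Rightarrow> ('a \<Rightarrow> real) \<Rightarrow> 'a measure" where
  "gibbs \<pi> c V = density \<pi> (\<lambda>x. ennreal (exp (- c * V x) / (\<integral>y. exp (- c * V y) \<partial>\<pi>)))"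

lemma quasi_posterior_eq_gibbs:
  "quasi_posterior \<phi> k n \<pi> Gb = gibbs \<pi> (real n / 2) (\<lambda>b. Gb (sieve_elem \<phi> k b))"
  by (simp add: quasi_posterior_def quasi_lik_def gibbs_def)

lemma space_gibbs [simp]: "space (gibbs \<pi> c V) = space \<pi>"
  and sets_gibbs [simp, measurable_cong]: "sets (gibbs \<pi> c V) = sets \<pi>"
  by (simp_all add: gibbs_def)

locale gibbs_setup = prob_space \<pi> for \<pi> :: "'a measure" +
  fixes c :: real and V :: "'a \<Rightarrow> real"
  assumes V_measurable [measurable]: "V \<in> borel_measurable \<pi>"
    and V_nonneg: "\<And>x. x \<in> space \<pi> \<Longrightarrow> 0 \<le> V x"
    and c_nonneg: "0 \<le> c"
begin

abbreviation partition_fun :: real where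
  "partition_fun \<equiv> \<integral>x. exp (- c * V x) \<partial>\<pi>"

lemma integrable_weight: "integrable \<pi> (\<lambda>x. exp (- c * V x))"
proof (rule integrable_const_bound[where B=1])
  show "AE x in \<pi>. norm (exp (- c * V x)) \<le> 1"
    using V_nonneg c_nonneg by (intro AE_I2) simp
qed simp

lemma integrable_weight_indicator:
  "S \<in> events \<Longrightarrow> integrable \<pi> (\<lambda>x. indicator S x * exp (- c * V x))"
  using integrable_mult_indicator[OF _ integrable_weight, of S] by simp

lemma partition_fun_pos: "0 < partition_fun"
proof -
  have "0 < (\<integral>x. exp (- c * V x) \<partial>\<pi>) \<longleftrightarrow> \<not> (AE x in \<pi>. exp (- c * V x) = 0)"
    using integral_nonneg_eq_0_iff_AE[OF integrable_weight]
      integral_nonneg_AE[of "\<lambda>x. exp (- c * V x)" \<pi>]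
    by (auto simp: less_le)
  then show ?thesis by simp
qed

lemma measure_gibbs:
  assumes S [measurable]: "S \<in> events"
  shows "measure (gibbs \<pi> c V) S = (\<integral>x. indicator S x * exp (- c * V x) \<partial>\<pi>) / partition_fun"
proof -
  have "emeasure (gibbs \<pi> c V) S
      = (\<integral>\<^sup>+x. ennreal (indicator S x * exp (- c * V x) / partition_fun) \<partial>\<pi>)"
    unfolding gibbs_def
    by (subst emeasure_density) (auto intro!: nn_integral_cong split: split_indicator)
  also have "\<dots> = ennreal (\<integral>x. indicator S x * exp (- c * V x) / partition_fun \<partial>\<pi>)"
    using partition_fun_pos integrable_weight_indicator[OF S]
    by (intro nn_integral_eq_integral AE_I2) auto
  finally show ?thesis
    using partition_fun_pos by (simp add: measure_def)
qed

lemma prob_space_gibbs: "prob_space (gibbs \<pi> c V)"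
proof -
  have "(\<integral>x. indicator (space \<pi>) x * exp (- c * V x) \<partial>\<pi>) = partition_fun"
    by (intro Bochner_Integration.integral_cong) auto
  then have "measure (gibbs \<pi> c V) (space \<pi>) = 1"
    using partition_fun_pos by (simp add: measure_gibbs)
  then have "emeasure (gibbs \<pi> c V) (space (gibbs \<pi> c V)) = 1"
    by (metis measure_eq_emeasure_eq_ennreal ennreal_1 space_gibbs zero_le_one zero_neq_one
        emeasure_eq_ennreal_measure enn2real_top measure_def)
  then show ?thesis by (rule prob_spaceI)
qed

lemma AE_gibbs:
  assumes "AE x in \<pi>. P x"
  shows "AE x in gibbs \<pi> c V. P x"
  using assms unfolding gibbs_def by (subst AE_density) auto

text \<open>Comparing the partition function with the part of it that comes from a low-energy set
  \<open>S\<close> bounds the mass of a high-energy set \<open>T\<close>. The estimate is in product form, so that a null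
  set \<open>S\<close> needs no separate treatment.\<close>

lemma gibbs_mass_le:
  assumes S [measurable]: "S \<in> events" and T [measurable]: "T \<in> events"
    and low: "\<And>x. x \<in> S \<Longrightarrow> V x \<le> s" and high: "\<And>x. x \<in> T \<Longrightarrow> t \<le> V x"
  shows "measure (gibbs \<pi> c V) T * (exp (- c * s) * prob S) \<le> exp (- c * t) * prob T"
proof -
  have "exp (- c * s) * prob S = (\<integral>x. indicator S x * exp (- c * s) \<partial>\<pi>)"
    using sets.sets_into_space[OF S] by (simp add: Int_absorb2)
  also have "\<dots> \<le> partition_fun"
    using low c_nonneg integrable_weight integrable_mult_indicator[OF S, of "\<lambda>_. exp (- c * s)"]
    by (intro integral_mono) (auto split: split_indicator intro: mult_left_mono)
  finally have "measure (gibbs \<pi> c V) T * (exp (- c * s) * prob S)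
      \<le> measure (gibbs \<pi> c V) T * partition_fun"
    by (rule mult_left_mono) simp
  also have "\<dots> = (\<integral>x. indicator T x * exp (- c * V x) \<partial>\<pi>)"
    using partition_fun_pos by (simp add: measure_gibbs)
  also have "\<dots> \<le> (\<integral>x. indicator T x * exp (- c * t) \<partial>\<pi>)"
    using high c_nonneg integrable_weight_indicator[OF T]
      integrable_mult_indicator[OF T, of "\<lambda>_. exp (- c * t)"]
    by (intro integral_mono) (auto split: split_indicator intro: mult_left_mono)
  also have "\<dots> = exp (- c * t) * prob T"
    using sets.sets_into_space[OF T] by (simp add: Int_absorb2)
  finally show ?thesis .
qed

text \<open>One estimate serves both bad regions, because \<open>small\<close> can be met in two ways: with
  \<open>t = m + 6 * d\<close> and \<open>B = 1\<close> by any set of high energy, and with \<open>t = 0\<close> by a set whose prior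
  mass is tiny. The numbers balance as \<open>6 = 2 + 4\<close>: the normalising constant is at least
  \<open>C * exp (- c * (m + 2 * d) - 4 * c * d)\<close>.\<close>

lemma gibbs_mass_le_ratio:
  assumes "S \<in> events" "T \<in> events"
    and low: "\<And>x. x \<in> S \<Longrightarrow> V x \<le> m + 2 * d" and mass: "C * exp (- (4 * c * d)) \<le> prob S"
    and high: "\<And>x. x \<in> T \<Longrightarrow> t \<le> V x"
    and small: "exp (- c * t) * prob T \<le> B * exp (- c * (m + 6 * d))"
    and C: "0 < C"
  shows "measure (gibbs \<pi> c V) T \<le> B / C"
proof -
  let ?p = "measure (gibbs \<pi> c V) T"
  have "?p * C * exp (- c * (m + 6 * d)) = ?p * (exp (- c * (m + 2 * d)) * (C * exp (- (4 * c * d))))"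
    by (simp add: algebra_simps flip: exp_add)
  also have "\<dots> \<le> ?p * (exp (- c * (m + 2 * d)) * prob S)"
    using mass by (intro mult_left_mono) auto
  also have "\<dots> \<le> exp (- c * t) * prob T"
    using assms by (intro gibbs_mass_le) auto
  also note small
  finally show ?thesis
    using C by (simp add: field_simps)
qed

end

text \<open>Both numerator and partition function of the Gibbs mass are integrals of the jointly
  measurable weight over the second coordinate, so measurability in the data comes from Fubini.\<close>

lemma measurable_gibbs_mass:
  assumes "prob_space \<pi>" and S [measurable]: "S \<in> sets \<pi>" and c: "0 \<le> c"
    and V [measurable]: "(\<lambda>(x, b). V x b) \<in> borel_measurable (K \<Otimes>\<^sub>M \<pi>)"
    and nonneg: "\<And>x b. x \<in> space K \<Longrightarrow> b \<in> space \<pi> \<Longrightarrow> 0 \<le> V x b"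
  shows "(\<lambda>x. measure (gibbs \<pi> c (V x)) S) \<in> borel_measurable K"
proof -
  interpret prob_space \<pi> by fact
  have "measure (gibbs \<pi> c (V x)) S
      = (\<integral>b. indicator S b * exp (- c * V x b) \<partial>\<pi>) / (\<integral>b. exp (- c * V x b) \<partial>\<pi>)"
    if x [measurable]: "x \<in> space K" for x
  proof -
    interpret gibbs_setup \<pi> c "V x"
      using c nonneg x by unfold_locales measurable
    show ?thesis by (rule measure_gibbs) fact
  qed
  moreover have "(\<lambda>x. (\<integral>b. indicator S b * exp (- c * V x b) \<partial>\<pi>) / (\<integral>b. exp (- c * V x b) \<partial>\<pi>))
      \<in> borel_measurable K"
    by measurable
  ultimately show ?thesis by (simp cong: measurable_cong)
qed

section \<open>Coefficient vectors and open sets of functions\<close>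

lemma sieve_elem_in_sieve_space: "sieve_elem \<phi> k b \<in> sieve_space \<phi> k"
  unfolding sieve_elem_def sieve_space_def
  by (intro span_sum span_scale span_base) auto

lemma continuous_on_sieve_elem:
  fixes \<phi> :: "nat \<Rightarrow> 'h::real_normed_vector"
  shows "continuous_on UNIV (sieve_elem \<phi> k)"
  unfolding sieve_elem_def
  by (intro continuous_intros continuous_on_product_coordinates)

lemma open_vimage_sieve_elem:
  fixes \<phi> :: "nat \<Rightarrow> 'h::real_normed_vector"
  shows "open U \<Longrightarrow> open (sieve_elem \<phi> k -` U)"
  using continuous_on_sieve_elem by (rule open_vimage[rotated])

text \<open>The space of functions need not be second countable, so Borel measurability of sums is not
  available there. Instead the preimage is taken on the side of the coefficients: it is open in the
  product topology of \<open>nat \<Rightarrow> real\<close>, whose Borel sets are the product sets.\<close>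

lemma sets_vimage_sieve_elem:
  fixes \<phi> :: "nat \<Rightarrow> 'h::real_normed_vector"
  assumes "open U"
  shows "{b \<in> space (coeff_space k). sieve_elem \<phi> k b \<in> U} \<in> sets (coeff_space k)"
proof -
  have "(\<lambda>b. b) \<in> coeff_space k \<rightarrow>\<^sub>M Pi\<^sub>M UNIV (\<lambda>_. borel :: real measure)"
  proof (rule measurable_PiM_single')
    fix i :: nat
    show "(\<lambda>b. b i) \<in> borel_measurable (coeff_space k)"
    proof (cases "i \<in> {1..k}")
      case False
      \<comment> \<open>off the index set, coefficient vectors take the default value\<close>
      then have "b i = undefined" if "b \<in> space (coeff_space k)" for b
        using that by (auto simp: space_PiM PiE_def extensional_def)
      then show ?thesis
        by (subst measurable_cong[where g="\<lambda>_. undefined"]) (assumption, simp)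
    qed simp
  qed simp
  then have "(\<lambda>b. b) \<in> coeff_space k \<rightarrow>\<^sub>M borel"
    by (simp add: measurable_cong_sets[OF refl sets_PiM_equal_borel])
  from measurable_sets[OF this, of "sieve_elem \<phi> k -` U"] open_vimage_sieve_elem[OF assms]
  have "sieve_elem \<phi> k -` U \<inter> space (coeff_space k) \<in> sets (coeff_space k)"
    by simp
  moreover have "sieve_elem \<phi> k -` U \<inter> space (coeff_space k)
      = {b \<in> space (coeff_space k). sieve_elem \<phi> k b \<in> U}"
    by auto
  ultimately show ?thesis by simp
qed

lemma open_enlargement: "open (enlargement A \<epsilon>)"
proof -
  have "enlargement A \<epsilon> = (\<Union>a\<in>A. ball a \<epsilon>)"
    by (auto simp: enlargement_def ext_dist_def INF_less_iff dist_norm norm_minus_commute)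
  also have "open \<dots>" by (intro open_UN ballI open_ball)
  finally show ?thesis .
qed

lemma closed_prior_support:
  assumes "prob_space \<pi>" "sets \<pi> = sets (coeff_space k)"
  shows "closed (prior_support \<phi> k \<pi>)"
  unfolding closed_def
proof (subst open_subopen, intro ballI)
  interpret prob_space \<pi> by fact
  fix f assume "f \<in> - prior_support \<phi> k \<pi>"
  then obtain r where r: "0 < r" "coeff_prob \<phi> k \<pi> (ball f r) \<le> 0"
    by (auto simp: prior_support_def not_less)
  have "h \<notin> prior_support \<phi> k \<pi>" if h: "h \<in> ball f r" for h
  proof -
    obtain s where s: "0 < s" "ball h s \<subseteq> ball f r"
      using openE[OF open_ball h] .
    have "coeff_prob \<phi> k \<pi> (ball h s) \<le> coeff_prob \<phi> k \<pi> (ball f r)"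
      unfolding coeff_prob_def
      using s(2) sets_vimage_sieve_elem[of "ball f r" k \<phi>] assms(2) sets_eq_imp_space_eq[OF assms(2)]
      by (intro finite_measure_mono) auto
    then show ?thesis using r s(1) by (force simp: prior_support_def)
  qed
  then show "\<exists>T. open T \<and> f \<in> T \<and> T \<subseteq> - prior_support \<phi> k \<pi>"
    using r(1) by (intro exI[of _ "ball f r"]) auto
qed

text \<open>The law of \<open>g\<^sub>b\<close> is carried by its support because it is the image of a measure on a second
  countable space: the null balls around the points off the support pull back to an open cover that
  has a countable subcover.\<close>

lemma AE_sieve_elem_in_prior_support:
  fixes \<phi> :: "nat \<Rightarrow> 'h::real_normed_vector"
  assumes "prob_space \<pi>" and sets_eq: "sets \<pi> = sets (coeff_space k)"
  shows "AE b in \<pi>. sieve_elem \<phi> k b \<in> prior_support \<phi> k \<pi>"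
proof -
  interpret prob_space \<pi> by fact
  note space_eq = sets_eq_imp_space_eq[OF sets_eq]
  define \<U> where "\<U> = {sieve_elem \<phi> k -` ball f r | f r. coeff_prob \<phi> k \<pi> (ball f r) \<le> 0}"
  have null: "U \<inter> space \<pi> \<in> null_sets \<pi>" if "U \<in> \<U>" for U
  proof -
    obtain f r where U: "U = sieve_elem \<phi> k -` ball f r" "coeff_prob \<phi> k \<pi> (ball f r) \<le> 0"
      using \<open>U \<in> \<U>\<close> by (auto simp: \<U>_def)
    have eq: "U \<inter> space \<pi> = {b \<in> space \<pi>. sieve_elem \<phi> k b \<in> ball f r}"
      using U(1) by auto
    have "measure \<pi> (U \<inter> space \<pi>) = 0"
      using U(2) by (simp add: eq coeff_prob_def measure_le_0_iff)
    moreover have "U \<inter> space \<pi> \<in> sets \<pi>"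
      unfolding eq unfolding sets_eq space_eq by (rule sets_vimage_sieve_elem) simp
    ultimately show ?thesis by (simp add: null_sets_def emeasure_eq_measure)
  qed
  have "open U" if "U \<in> \<U>" for U
    using that open_vimage_sieve_elem[OF open_ball] by (auto simp: \<U>_def)
  then obtain \<V> where \<V>: "\<V> \<subseteq> \<U>" "countable \<V>" "\<Union>\<V> = \<Union>\<U>"
    using Lindelof by metis
  have "(\<Union>U\<in>\<V>. U \<inter> space \<pi>) \<in> null_sets \<pi>"
    using \<V>(1,2) null by (intro null_sets_UN') auto
  moreover have "{b \<in> space \<pi>. sieve_elem \<phi> k b \<notin> prior_support \<phi> k \<pi>} \<subseteq> (\<Union>U\<in>\<V>. U \<inter> space \<pi>)"
  proof
    fix b assume b: "b \<in> {b \<in> space \<pi>. sieve_elem \<phi> k b \<notin> prior_support \<phi> k \<pi>}"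
    then obtain r where "0 < r" "coeff_prob \<phi> k \<pi> (ball (sieve_elem \<phi> k b) r) \<le> 0"
      by (auto simp: prior_support_def not_less)
    then have "b \<in> \<Union>\<U>" by (force simp: \<U>_def)
    with b \<V>(3) show "b \<in> (\<Union>U\<in>\<V>. U \<inter> space \<pi>)" by auto
  qed
  ultimately show ?thesis by (rule AE_I')
qed

section \<open>Concentration of the quasi-posterior\<close>

theorem theorem2p2:
  fixes M :: "'w measure" and N :: "'x measure" and X :: "nat \<Rightarrow> 'w \<Rightarrow> 'x"
    and \<phi> :: "nat \<Rightarrow> 'h::banach" and q :: "nat \<Rightarrow> nat"
    and G :: "'h \<Rightarrow> real" and Gbar :: "nat \<Rightarrow> (nat \<Rightarrow> 'x) \<Rightarrow> 'h \<Rightarrow> real"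
    and prior :: "nat \<Rightarrow> (nat \<Rightarrow> real) measure"
    and F Fc :: "nat \<Rightarrow> 'h set" and \<delta> :: "nat \<Rightarrow> real"
  defines "H \<equiv> \<lambda>n. sieve_space \<phi> (q n)"
    and "g \<equiv> \<lambda>n. sieve_elem \<phi> (q n)"
    and "\<Theta> \<equiv> identified_region G"
    and "Gb \<equiv> \<lambda>n \<omega>. Gbar n (sample_vec X n \<omega>)"
    and "Prior \<equiv> \<lambda>n. coeff_prob \<phi> (q n) (prior n)"
    and "Post \<equiv> \<lambda>n \<omega>. coeff_prob \<phi> (q n)
                  (quasi_posterior \<phi> (q n) n (prior n) (Gbar n (sample_vec X n \<omega>)))"
  assumes inf_dim: "\<not> (\<exists>B::'h set. finite B \<and> span B = UNIV)"
    and q_lim: "filterlim q at_top sequentially"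
    and dense: "closure (\<Union>n. H n) = UNIV"
    and M: "prob_space M"
    and indep: "prob_space.indep_vars M (\<lambda>_. N) X {1..}"
    and ident: "\<forall>i\<ge>1. distr M N (X i) = distr M N (X 1)"
    and G_nonneg: "\<forall>f. 0 \<le> G f"
    and G_meas: "\<forall>n. (\<lambda>b. G (g n b)) \<in> borel_measurable (coeff_space (q n))"
    and Gbar_nonneg: "\<forall>n. \<forall>x\<in>space (Pi\<^sub>M {1..n} (\<lambda>_. N)). \<forall>f\<in>H n. 0 \<le> Gbar n x f"
    and Gbar_meas: "\<forall>n. (\<lambda>(x, b). Gbar n x (g n b))
          \<in> borel_measurable (Pi\<^sub>M {1..n} (\<lambda>_. N) \<Otimes>\<^sub>M coeff_space (q n))"
    and prior_prob: "\<forall>n. prob_space (prior n)"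
    and prior_sets: "\<forall>n. sets (prior n) = sets (coeff_space (q n))"
    and partition: "\<forall>n. F n \<inter> Fc n = {} \<and> F n \<union> Fc n = prior_support \<phi> (q n) (prior n)"
    and F_bounded: "\<forall>n. F n \<subseteq> H n \<and> bounded (F n)"
    and F_meas: "\<forall>n. {b \<in> space (coeff_space (q n)). g n b \<in> F n} \<in> sets (coeff_space (q n))"
    and \<delta>_pos: "\<forall>n. 0 < \<delta> n"
    and tail: "(\<lambda>n. \<integral>\<omega>. Post n \<omega> (Fc n) \<partial>M) \<in> o(\<lambda>_. 1) \<or>
          (\<lambda>n. Prior n (Fc n)) \<in> O(\<lambda>n. exp (- 4 * real n * \<delta> n) * exp (- (real n / 2) * (INF f. G f)))"
    and approx: "(\<lambda>n. ereal (Prior n {f. G f - (INF f'. G f') < \<delta> n \<and> f \<in> F n}))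
          \<succ>\<succ> (\<lambda>n. exp (- 2 * real n * \<delta> n))"
    and unif_meas: "\<forall>n. {\<omega> \<in> space M. (SUP f\<in>F n. ereal \<bar>Gb n \<omega> f - G f\<bar>) \<ge> ereal (\<delta> n)} \<in> sets M"
    and unif: "(\<lambda>n. measure M {\<omega> \<in> space M. (SUP f\<in>F n. ereal \<bar>Gb n \<omega> f - G f\<bar>) \<ge> ereal (\<delta> n)})
          \<in> o(\<lambda>_. 1)"
    and disting: "\<forall>\<epsilon>>0. (\<lambda>n. (INF f\<in>{f \<in> H n. f \<notin> enlargement \<Theta> \<epsilon>}. ereal (G f)) - ereal (INF f. G f))
          \<succ>\<succ> \<delta>"
  shows "\<forall>\<epsilon>>0. tendsto_in_prob M (\<lambda>n \<omega>. Post n \<omega> (enlargement \<Theta> \<epsilon>)) 1"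
proof -
  interpret prob_space M by (rule M)
  note [measurable_cong] = prior_sets[rule_format]
  note space_prior = sets_eq_imp_space_eq[OF prior_sets[rule_format]]

  define c where "c = (\<lambda>n. real n / 2)"
  define m where "m = (INF f. G f)"
  define V where "V = (\<lambda>n \<omega> b. Gb n \<omega> (g n b))"
  define coeffs where "coeffs = (\<lambda>n A. {b \<in> space (prior n). g n b \<in> A})"
  define bad where "bad = (\<lambda>n. {\<omega> \<in> space M. (SUP f\<in>F n. ereal \<bar>Gb n \<omega> f - G f\<bar>) \<ge> ereal (\<delta> n)})"

  have Prior_eq: "Prior n A = measure (prior n) (coeffs n A)" for n A
    by (simp add: Prior_def coeff_prob_def coeffs_def g_def)
  have Post_eq: "Post n \<omega> A = measure (gibbs (prior n) (c n) (V n \<omega>)) (coeffs n A)" for n \<omega> A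
    by (simp add: Post_def coeff_prob_def coeffs_def g_def quasi_posterior_eq_gibbs V_def Gb_def c_def)

  have X_meas: "X i \<in> M \<rightarrow>\<^sub>M N" if "i \<ge> 1" for i
    using indep that by (auto simp: indep_vars_def)
  have sample_meas [measurable]: "sample_vec X n \<in> M \<rightarrow>\<^sub>M Pi\<^sub>M {1..n} (\<lambda>_. N)" for n
    unfolding sample_vec_def using X_meas by (intro measurable_restrict) auto
  have g_in_H: "g n b \<in> H n" for n b
    by (simp add: g_def H_def sieve_elem_in_sieve_space)

  have V_meas: "(\<lambda>(\<omega>, b). V n \<omega> b) \<in> borel_measurable (M \<Otimes>\<^sub>M prior n)" for n
  proof -
    have "(\<lambda>p. (sample_vec X n (fst p), snd p))
        \<in> M \<Otimes>\<^sub>M prior n \<rightarrow>\<^sub>M Pi\<^sub>M {1..n} (\<lambda>_. N) \<Otimes>\<^sub>M coeff_space (q n)"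
      by measurable
    from measurable_compose[OF this Gbar_meas[rule_format, of n]]
    show ?thesis by (simp add: V_def Gb_def case_prod_beta)
  qed
  have V_nonneg: "0 \<le> V n \<omega> b" if "\<omega> \<in> space M" for n \<omega> b
    using Gbar_nonneg measurable_space[OF sample_meas that] g_in_H by (simp add: V_def Gb_def)
  have gibbs: "gibbs_setup (prior n) (c n) (V n \<omega>)" if "\<omega> \<in> space M" for n \<omega>
  proof -
    interpret P: prob_space "prior n" using prior_prob by simp
    show ?thesis
      using measurable_Pair2[OF V_meas that] V_nonneg[OF that] by unfold_locales (auto simp: c_def)
  qed

  have coeffs_enl: "coeffs n (enlargement \<Theta> \<epsilon>) \<in> sets (prior n)" for n \<epsilon>
    using sets_vimage_sieve_elem[OF open_enlargement]
    by (simp add: coeffs_def g_def prior_sets space_prior)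
  have coeffs_F: "coeffs n (F n) \<in> sets (prior n)" for n
    using F_meas by (simp add: coeffs_def prior_sets space_prior)
  \<comment> \<open>measurability of the complement of the sieve comes from closedness of the support\<close>
  have coeffs_Fc: "coeffs n (Fc n) \<in> sets (prior n)" for n
  proof -
    let ?S = "prior_support \<phi> (q n) (prior n)"
    have "open (- ?S)"
      using closed_prior_support[OF prior_prob[rule_format] prior_sets[rule_format], where \<phi>=\<phi>]
      by (rule open_Compl)
    then have "coeffs n (- ?S) \<in> sets (prior n)"
      using sets_vimage_sieve_elem by (simp add: coeffs_def g_def prior_sets space_prior del: Compl_iff)
    moreover have "coeffs n (Fc n) = space (prior n) - coeffs n (- ?S) - coeffs n (F n)"
      using partition[rule_format, of n] by (auto simp: coeffs_def)
    ultimately show ?thesis using coeffs_F by auto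
  qed
  have coeffs_diff: "coeffs n (F n - enlargement \<Theta> \<epsilon>) \<in> sets (prior n)" for n \<epsilon>
  proof -
    have "coeffs n (F n - enlargement \<Theta> \<epsilon>) = coeffs n (F n) - coeffs n (enlargement \<Theta> \<epsilon>)"
      by (auto simp: coeffs_def)
    then show ?thesis using coeffs_F coeffs_enl by auto
  qed
  \<comment> \<open>the nearly optimal part of the sieve, which bounds the normalising constant from below\<close>
  define near where "near = (\<lambda>n. {f. G f - m < \<delta> n \<and> f \<in> F n})"
  have coeffs_near: "coeffs n (near n) \<in> sets (prior n)" for n
  proof -
    have [measurable]: "(\<lambda>b. G (g n b)) \<in> borel_measurable (prior n)"
      using G_meas by (simp add: measurable_cong_sets[OF prior_sets[rule_format] refl])
    have "{b \<in> space (prior n). G (g n b) - m < \<delta> n} \<in> sets (prior n)"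
      by measurable
    moreover have "coeffs n (near n) = {b \<in> space (prior n). G (g n b) - m < \<delta> n} \<inter> coeffs n (F n)"
      by (auto simp: coeffs_def near_def)
    ultimately show ?thesis using coeffs_F by auto
  qed

  have Post_Fc_meas: "(\<lambda>\<omega>. Post n \<omega> (Fc n)) \<in> borel_measurable M" for n
    unfolding Post_eq using prior_prob coeffs_Fc V_meas V_nonneg
    by (intro measurable_gibbs_mass) (auto simp: c_def)

  have good: "\<bar>Gb n \<omega> f - G f\<bar> < \<delta> n" if "\<omega> \<in> space M - bad n" "f \<in> F n" for n \<omega> f
  proof -
    have "(SUP f\<in>F n. ereal \<bar>Gb n \<omega> f - G f\<bar>) < ereal (\<delta> n)"
      using that(1) by (auto simp: bad_def not_le)
    with SUP_upper[OF that(2), of "\<lambda>f. ereal \<bar>Gb n \<omega> f - G f\<bar>"] show ?thesis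
      by (metis le_less_trans less_ereal.simps(1))
  qed
  \<comment> \<open>the constant \<open>C\<close> is arbitrary: this is where the strict domination in the approximation
    condition enters, and it supplies the convergence to \<open>0\<close> even if \<open>n \<delta>\<^sub>n\<close> stays bounded\<close>
  have mass_near: "\<forall>\<^sub>F n in sequentially. C * exp (- (4 * c n * \<delta> n)) \<le> measure (prior n) (coeffs n (near n))"
    if "C > 0" for C
  proof -
    have "\<forall>\<^sub>F n in sequentially. ereal (exp (- 2 * real n * \<delta> n)) \<le> ereal (1 / C) * ereal (Prior n (near n))"
      using approx[unfolded dominates_def, rule_format, of "1 / C"] that
      unfolding near_def m_def by simp
    then show ?thesis
      by eventually_elim (use that in \<open>simp add: Prior_eq c_def field_simps\<close>)
  qed
  have low: "V n \<omega> b \<le> m + 2 * \<delta> n" if "\<omega> \<in> space M - bad n" "b \<in> coeffs n (near n)" for n \<omega> b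
    using good[OF that(1), of "g n b"] that(2) by (auto simp: coeffs_def near_def V_def)

  have far: "\<forall>\<^sub>F n in sequentially. \<forall>\<omega>\<in>space M - bad n. Post n \<omega> (F n - enlargement \<Theta> \<epsilon>) \<le> \<eta>"
    if "\<epsilon> > 0" "\<eta> > 0" for \<epsilon> \<eta>
  proof -
    have "\<forall>\<^sub>F n in sequentially. ereal (\<delta> n)
        \<le> ereal (1 / 7) * ((INF f\<in>{f \<in> H n. f \<notin> enlargement \<Theta> \<epsilon>}. ereal (G f)) - ereal m)"
      using disting[rule_format, OF that(1), unfolded dominates_def, rule_format, of "1 / 7"]
      unfolding m_def by simp
    moreover have "\<forall>\<^sub>F n in sequentially.
        1 / \<eta> * exp (- (4 * c n * \<delta> n)) \<le> measure (prior n) (coeffs n (near n))"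
      using that by (intro mass_near) simp
    ultimately show ?thesis
      \<comment> \<open>a gap of \<open>7 \<delta>\<^sub>n\<close> in \<open>G\<close> leaves \<open>6 \<delta>\<^sub>n\<close> in the sample risk; of these, \<open>2 \<delta>\<^sub>n\<close> offset the
        energy of the nearly optimal set and \<open>4 \<delta>\<^sub>n\<close> its prior mass \<open>exp (- 2 n \<delta>\<^sub>n)\<close>\<close>
    proof (eventually_elim, intro ballI)
      fix n \<omega>
      assume gap: "ereal (\<delta> n)
          \<le> ereal (1 / 7) * ((INF f\<in>{f \<in> H n. f \<notin> enlargement \<Theta> \<epsilon>}. ereal (G f)) - ereal m)"
        and mass: "1 / \<eta> * exp (- (4 * c n * \<delta> n)) \<le> measure (prior n) (coeffs n (near n))"
        and \<omega>: "\<omega> \<in> space M - bad n"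
      interpret P: gibbs_setup "prior n" "c n" "V n \<omega>" using gibbs \<omega> by simp
      have high: "m + 6 * \<delta> n \<le> V n \<omega> b" if b: "b \<in> coeffs n (F n - enlargement \<Theta> \<epsilon>)" for b
      proof -
        have "g n b \<in> F n" "g n b \<in> {f \<in> H n. f \<notin> enlargement \<Theta> \<epsilon>}"
          using b g_in_H by (auto simp: coeffs_def)
        note gap
        also have "ereal (1 / 7) * ((INF f\<in>{f \<in> H n. f \<notin> enlargement \<Theta> \<epsilon>}. ereal (G f)) - ereal m)
            \<le> ereal (1 / 7) * (ereal (G (g n b)) - ereal m)"
          using \<open>g n b \<in> {f \<in> H n. f \<notin> enlargement \<Theta> \<epsilon>}\<close>
          by (intro ereal_mult_left_mono ereal_minus_mono INF_lower) auto
        finally show ?thesis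
          using good[OF \<omega> \<open>g n b \<in> F n\<close>] by (auto simp: V_def)
      qed
      have "measure (gibbs (prior n) (c n) (V n \<omega>)) (coeffs n (F n - enlargement \<Theta> \<epsilon>)) \<le> 1 / (1 / \<eta>)"
        using that mass low[OF \<omega>] high coeffs_near coeffs_diff
        by (intro P.gibbs_mass_le_ratio[where S="coeffs n (near n)" and m=m and d="\<delta> n"
              and t="m + 6 * \<delta> n"]) auto
      then show "Post n \<omega> (F n - enlargement \<Theta> \<epsilon>) \<le> \<eta>" by (simp add: Post_eq)
    qed
  qed

  have off_sieve: "(\<lambda>n. prob {\<omega> \<in> space M - bad n. Post n \<omega> (Fc n) > \<eta>}) \<longlonglongrightarrow> 0" if "\<eta> > 0" for \<eta>
    using tail
  proof
    \<comment> \<open>a vanishing mean gives convergence in probability by Markov's inequality\<close>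
    assume "(\<lambda>n. \<integral>\<omega>. Post n \<omega> (Fc n) \<partial>M) \<in> o(\<lambda>_. 1)"
    from smalloD_tendsto[OF this] have lim: "(\<lambda>n. (\<integral>\<omega>. Post n \<omega> (Fc n) \<partial>M) / \<eta>) \<longlonglongrightarrow> 0"
      by (intro tendsto_divide_zero) simp
    have le: "prob {\<omega> \<in> space M - bad n. Post n \<omega> (Fc n) > \<eta>} \<le> (\<integral>\<omega>. Post n \<omega> (Fc n) \<partial>M) / \<eta>" for n
    proof -
      note [measurable] = Post_Fc_meas[of n]
      have "integrable M (\<lambda>\<omega>. Post n \<omega> (Fc n))"
      proof (rule integrable_const_bound[where B=1])
        show "AE \<omega> in M. norm (Post n \<omega> (Fc n)) \<le> 1"
        proof (rule AE_I2)
          fix \<omega> assume "\<omega> \<in> space M"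
          then show "norm (Post n \<omega> (Fc n)) \<le> 1"
            unfolding Post_eq
            using prob_space.prob_le_1[OF gibbs_setup.prob_space_gibbs[OF gibbs]] by simp
        qed
      qed measurable
      then have "prob {\<omega> \<in> space M. \<eta> \<le> Post n \<omega> (Fc n)} \<le> (\<integral>\<omega>. Post n \<omega> (Fc n) \<partial>M) / \<eta>"
        using that by (intro integral_Markov_inequality_measure[where A="{}"]) (simp_all add: Post_eq)
      moreover have "prob {\<omega> \<in> space M - bad n. Post n \<omega> (Fc n) > \<eta>}
          \<le> prob {\<omega> \<in> space M. \<eta> \<le> Post n \<omega> (Fc n)}"
        by (intro finite_measure_mono) auto
      ultimately show ?thesis by linarith
    qed
    show ?thesis
      by (rule tendsto_sandwich[OF _ _ tendsto_const lim]; intro always_eventually allI le measure_nonneg)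
  next
    assume "(\<lambda>n. Prior n (Fc n))
        \<in> O(\<lambda>n. exp (- 4 * real n * \<delta> n) * exp (- (real n / 2) * (INF f. G f)))"
    then obtain B where "B > 0" and B: "\<forall>\<^sub>F n in sequentially.
        norm (Prior n (Fc n)) \<le> B * norm (exp (- 4 * real n * \<delta> n) * exp (- (real n / 2) * (INF f. G f)))"
      by (rule landau_o.bigE)
    have "\<forall>\<^sub>F n in sequentially.
        B / \<eta> * exp (- (4 * c n * \<delta> n)) \<le> measure (prior n) (coeffs n (near n))"
      using that \<open>B > 0\<close> by (intro mass_near) simp
    with B have "\<forall>\<^sub>F n in sequentially. prob {\<omega> \<in> space M - bad n. Post n \<omega> (Fc n) > \<eta>} = 0"
    proof eventually_elim
      case (elim n)
      \<comment> \<open>off the sieve only \<open>0 \<le> V\<close> is known, so the prior mass alone has to be small\<close>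
      have "Post n \<omega> (Fc n) \<le> \<eta>" if \<omega>: "\<omega> \<in> space M - bad n" for \<omega>
      proof -
        interpret P: gibbs_setup "prior n" "c n" "V n \<omega>" using gibbs \<omega> by simp
        have "measure (prior n) (coeffs n (Fc n)) \<le> B * exp (- c n * (m + 8 * \<delta> n))"
          using elim(1) by (simp add: Prior_eq m_def c_def algebra_simps flip: exp_add)
        also have "\<dots> \<le> B * exp (- c n * (m + 6 * \<delta> n))"
          using \<open>B > 0\<close> \<delta>_pos[rule_format, of n] by (simp add: c_def mult_left_mono)
        finally have "measure (gibbs (prior n) (c n) (V n \<omega>)) (coeffs n (Fc n)) \<le> B / (B / \<eta>)"
          using \<open>\<eta> > 0\<close> \<open>B > 0\<close> elim(2) low[OF \<omega>] coeffs_near coeffs_Fc V_nonneg \<omega>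
          by (intro P.gibbs_mass_le_ratio[where S="coeffs n (near n)" and m=m and d="\<delta> n" and t=0]) auto
        then show ?thesis using \<open>B > 0\<close> by (simp add: Post_eq)
      qed
      then have "{\<omega> \<in> space M - bad n. Post n \<omega> (Fc n) > \<eta>} = {}"
        by (metis (mono_tags, lifting) empty_Collect_eq leD)
      then show ?case by (metis measure_empty)
    qed
    then show ?thesis by (rule tendsto_eventually)
  qed

  have Post_split: "\<bar>Post n \<omega> (enlargement \<Theta> \<epsilon>) - 1\<bar>
      \<le> Post n \<omega> (Fc n) + Post n \<omega> (F n - enlargement \<Theta> \<epsilon>)" if \<omega>: "\<omega> \<in> space M" for n \<omega> \<epsilon>
  proof -
    let ?\<mu> = "gibbs (prior n) (c n) (V n \<omega>)"
    let ?U = "coeffs n (enlargement \<Theta> \<epsilon>)" and ?N = "coeffs n (Fc n)"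
      and ?D = "coeffs n (F n - enlargement \<Theta> \<epsilon>)"
    interpret P: gibbs_setup "prior n" "c n" "V n \<omega>" using gibbs \<omega> by simp
    interpret Q: prob_space ?\<mu> by (rule P.prob_space_gibbs)
    have "AE b in ?\<mu>. g n b \<in> F n \<union> Fc n"
      using AE_sieve_elem_in_prior_support[OF prior_prob[rule_format] prior_sets[rule_format],
          where \<phi>=\<phi>] partition
      by (intro P.AE_gibbs) (simp add: g_def)
    from this AE_space have "AE b in ?\<mu>. b \<in> ?U \<union> (?N \<union> ?D)"
      by eventually_elim (auto simp: coeffs_def)
    moreover have ev: "?U \<in> Q.events" "?N \<in> Q.events" "?D \<in> Q.events"
      using coeffs_enl coeffs_Fc coeffs_diff by simp_all
    then have "?U \<union> (?N \<union> ?D) \<in> Q.events" by blast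
    ultimately have "1 = Q.prob (?U \<union> (?N \<union> ?D))"
      using Q.prob_eq_1 by metis
    also have "\<dots> \<le> Q.prob ?U + Q.prob (?N \<union> ?D)"
      using ev by (intro measure_Un_le) auto
    also have "Q.prob (?N \<union> ?D) \<le> Q.prob ?N + Q.prob ?D"
      using ev by (intro measure_Un_le) auto
    finally show ?thesis
      using Q.prob_le_1[of ?U] by (simp add: Post_eq)
  qed

  show ?thesis
    unfolding tendsto_in_prob_def
  proof (intro allI impI)
    fix \<epsilon> \<eta> :: real assume "0 < \<epsilon>" "0 < \<eta>"
    let ?out = "\<lambda>n. {\<omega> \<in> space M - bad n. Post n \<omega> (Fc n) > \<eta> / 2}"
    have "(\<lambda>n. prob (bad n)) \<longlonglongrightarrow> 0"
      using smalloD_tendsto[OF unif] by (simp add: bad_def)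
    from tendsto_add[OF this off_sieve[of "\<eta> / 2"]]
    have lim: "(\<lambda>n. prob (bad n) + prob (?out n)) \<longlonglongrightarrow> 0"
      using \<open>0 < \<eta>\<close> by simp
    have "\<forall>\<^sub>F n in sequentially. \<forall>\<omega>\<in>space M - bad n. Post n \<omega> (F n - enlargement \<Theta> \<epsilon>) \<le> \<eta> / 2"
      using \<open>0 < \<epsilon>\<close> \<open>0 < \<eta>\<close> by (intro far) auto
    then have "\<forall>\<^sub>F n in sequentially.
        prob {\<omega> \<in> space M. \<eta> < \<bar>Post n \<omega> (enlargement \<Theta> \<epsilon>) - 1\<bar>} \<le> prob (bad n) + prob (?out n)"
    proof eventually_elim
      case (elim n)
      note [measurable] = Post_Fc_meas[of n]
      have bad_meas [measurable]: "bad n \<in> sets M" using unif_meas by (simp add: bad_def)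
      have "?out n = {\<omega> \<in> space M. Post n \<omega> (Fc n) > \<eta> / 2} - bad n" by auto
      then have out_meas: "?out n \<in> sets M" by simp
      have "{\<omega> \<in> space M. \<eta> < \<bar>Post n \<omega> (enlargement \<Theta> \<epsilon>) - 1\<bar>} \<subseteq> bad n \<union> ?out n"
      proof
        fix \<omega> assume \<omega>: "\<omega> \<in> {\<omega> \<in> space M. \<eta> < \<bar>Post n \<omega> (enlargement \<Theta> \<epsilon>) - 1\<bar>}"
        show "\<omega> \<in> bad n \<union> ?out n"
        proof (cases "\<omega> \<in> bad n")
          case False
          then have "Post n \<omega> (F n - enlargement \<Theta> \<epsilon>) \<le> \<eta> / 2"
            using elim \<omega> by blast
          then have "Post n \<omega> (Fc n) > \<eta> / 2"
            using Post_split[of \<omega> n \<epsilon>] \<omega> by simp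
          then show ?thesis using False \<omega> by simp
        qed simp
      qed
      then have "prob {\<omega> \<in> space M. \<eta> < \<bar>Post n \<omega> (enlargement \<Theta> \<epsilon>) - 1\<bar>} \<le> prob (bad n \<union> ?out n)"
        using bad_meas out_meas by (intro finite_measure_mono) auto
      also have "\<dots> \<le> prob (bad n) + prob (?out n)"
        using bad_meas out_meas by (rule measure_Un_le)
      finally show ?case .
    qed
    then show "(\<lambda>n. prob {\<omega> \<in> space M. \<eta> < \<bar>Post n \<omega> (enlargement \<Theta> \<epsilon>) - 1\<bar>}) \<longlonglongrightarrow> 0"
      by (rule tendsto_sandwich[OF _ _ tendsto_const lim, rotated]) simp
  qed
qed

end
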